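(* For all $k\ge 1$, we have $$\sum_{n\geq 1}\mathrm{ch}(K_{n,k})(t)\,u^n =\sum_{n\geq 1}\frac{(t)_{n}\left[(t-n)^k + (n-1)(t-(n-1))^{k-1}\right]u^n}{\prod_{i=0}^{n-1}(1-iu)}.$$
   Context: $\mathrm{ch}(G)(t)$ denotes the chromatic polynomial of a finite graph $G$, and $K_{n,k}$ is the complete bipartite graph with parts of sizes $n$ and $k$. $(t)_n=t(t-1)\cdots(t-(n-1))$. The identity is one of formal power series in $u$ with coefficients in $\mathbb{Z}[t]$. *)

theory Defs
  imports
    "HOL-Analysis.Infinite_Sum"
    "HOL-Computational_Algebra.Computational_Algebra"
    "Graph_Theory.Graph_Theory"
begin

text \<open>
  Finite simple graphs are the loop-free symmetric finite digraphs without multiple arcs of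
  \<^locale>\<open>graph\<close>, and the complete bipartite graphs are given by
  \<^const>\<open>complete_bipartite_digraph\<close>.
\<close>

definition proper_colourings :: "('a, 'b) pre_digraph \<Rightarrow> nat \<Rightarrow> ('a \<Rightarrow> nat) set" where
  "proper_colourings G q =
     {f \<in> verts G \<rightarrow>\<^sub>E {..<q}. \<forall>(u, v) \<in> arcs_ends G. f u \<noteq> f v}"

text \<open>
  The unique polynomial in \<open>\<int>[t]\<close> whose value at each natural number \<open>q\<close> is the number of proper
  colourings with \<open>q\<close> colours.  Existence and uniqueness are proved below (\<open>chromatic_poly_unique_existence\<close>)
  for every digraph with finitely many vertices.
\<close>

definition chromatic_poly :: "('a, 'b) pre_digraph \<Rightarrow> int poly" where
  "chromatic_poly G =
     (THE p. \<forall>q::nat. poly p (of_nat q) = of_nat (card (proper_colourings G q)))"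

definition falling_factorial :: "'a :: comm_ring_1 \<Rightarrow> nat \<Rightarrow> 'a" where
  "falling_factorial x n = (\<Prod>i<n. x - of_nat i)"


lemma poly_falling_factorial:
  "poly (falling_factorial [:0, 1:] n) (of_nat q :: int) = of_nat (\<Prod>i<n. q - i)"
proof (cases "n \<le> q")
  case True
  then show ?thesis
    unfolding falling_factorial_def poly_prod of_nat_prod
    by (intro prod.cong) (auto simp: of_nat_diff)
next
  case False
  then have "q \<in> {..<n}" by simp
  then have "(\<Prod>i<n. q - i) = 0" and "(\<Prod>i<n. int q - int i) = 0"
    by (auto intro: prod_zero bexI[of _ q])
  then show ?thesis
    unfolding falling_factorial_def by (simp add: poly_prod del: prod_zero_iff of_nat_prod)
qed

lemma card_maps_with_kernel:
  fixes V :: "'a set" and Q :: "'c set"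
  assumes r: "equiv V r" and "finite V" "finite Q"
  shows "card {f \<in> V \<rightarrow>\<^sub>E Q. {(x, y) \<in> V \<times> V. f x = f y} = r} =
           (\<Prod>i<card (V // r). card Q - i)"
proof -
  let ?I = "{g \<in> V // r \<rightarrow>\<^sub>E Q. inj_on g (V // r)}"
  let ?C = "{f \<in> V \<rightarrow>\<^sub>E Q. {(x, y) \<in> V \<times> V. f x = f y} = r}"
  let ?F = "\<lambda>g. \<lambda>x\<in>V. g (r `` {x})"
  have "bij_betw ?F ?I ?C"
    unfolding bij_betw_def
  proof (intro conjI inj_onI subset_antisym subsetI)
    fix g g' assume g: "g \<in> ?I" and g': "g' \<in> ?I" and eq: "?F g = ?F g'"
    show "g = g'"
    proof (rule PiE_ext[of g "V // r" "\<lambda>_. Q" g'])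
      fix B assume "B \<in> V // r"
      then obtain x where x: "x \<in> V" "B = r `` {x}" by (auto elim: quotientE)
      then show "g B = g' B" using fun_cong[OF eq, of x] by simp
    qed (use g g' in auto)
  next
    fix f assume "f \<in> ?F ` ?I"
    then obtain g where g: "g \<in> ?I" and f: "f = ?F g" by auto
    have "f x = f y \<longleftrightarrow> (x, y) \<in> r" if "x \<in> V" "y \<in> V" for x y
    proof -
      have "f x = f y \<longleftrightarrow> g (r `` {x}) = g (r `` {y})" using that f by simp
      also have "\<dots> \<longleftrightarrow> r `` {x} = r `` {y}"
        using g that by (auto simp: inj_on_eq_iff quotientI)
      also have "\<dots> \<longleftrightarrow> (x, y) \<in> r" using r that by (simp add: eq_equiv_class_iff)
      finally show ?thesis .
    qed
    moreover have "r \<subseteq> V \<times> V" using r by (auto simp: equiv_def)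
    ultimately have "{(x, y) \<in> V \<times> V. f x = f y} = r" by auto
    moreover have "f \<in> V \<rightarrow>\<^sub>E Q" using g f by (auto simp: quotientI)
    ultimately show "f \<in> ?C" by simp
  next
    fix f assume f: "f \<in> ?C"
    then have k: "f x = f y \<longleftrightarrow> (x, y) \<in> r" if "x \<in> V" "y \<in> V" for x y
      using that by auto
    define g where "g = (\<lambda>B\<in>V // r. f (SOME x. x \<in> B))"
    have gx: "g (r `` {x}) = f x" if x: "x \<in> V" for x
    proof -
      have "x \<in> r `` {x}" using r x by (rule equiv_class_self)
      then have "(SOME y. y \<in> r `` {x}) \<in> r `` {x}" by (rule someI)
      then have "(x, SOME y. y \<in> r `` {x}) \<in> r" by simp
      moreover from this have "(SOME y. y \<in> r `` {x}) \<in> V" using r by (auto simp: equiv_def)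
      ultimately have "f x = f (SOME y. y \<in> r `` {x})" using k x by blast
      then show ?thesis using x by (simp add: g_def quotientI)
    qed
    have "g \<in> V // r \<rightarrow>\<^sub>E Q"
    proof (rule PiE_I)
      fix B assume "B \<in> V // r"
      then obtain x where "x \<in> V" "B = r `` {x}" by (auto elim: quotientE)
      then show "g B \<in> Q" using gx f by auto
    qed (simp add: g_def)
    moreover have "inj_on g (V // r)"
    proof (rule inj_onI)
      fix A B assume "A \<in> V // r" "B \<in> V // r" and eq: "g A = g B"
      then obtain x y where "x \<in> V" "A = r `` {x}" "y \<in> V" "B = r `` {y}"
        by (auto elim!: quotientE)
      then show "A = B" using eq gx k r by (simp add: eq_equiv_class_iff)
    qed
    moreover have "f = ?F g"
    proof (rule PiE_ext[of f V "\<lambda>_. Q"])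
      show "?F g \<in> V \<rightarrow>\<^sub>E Q" using gx f by auto
    qed (use f gx in auto)
    ultimately show "f \<in> ?F ` ?I" by blast
  qed
  then have "card ?C = card ?I" by (simp add: bij_betw_same_card)
  also have "\<dots> = (\<Prod>i<card (V // r). card Q - i)"
    using card_inj_on_subset_funcset[of "V // r" Q "V // r"] assms
    by (simp add: finite_quotient equiv_type atLeast0LessThan)
  finally show ?thesis .
qed

lemma chromatic_poly_unique_existence:
  fixes G :: "('a, 'b) pre_digraph"
  assumes fin: "finite (verts G)" and wf: "arcs_ends G \<subseteq> verts G \<times> verts G"
  shows "\<exists>!p::int poly. \<forall>q::nat. poly p (of_nat q) = of_nat (card (proper_colourings G q))"
proof (rule ex_ex1I)
  let ?V = "verts G"
  define R where "R = {r. equiv ?V r \<and> r \<inter> arcs_ends G = {}}"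
  have "R \<subseteq> Pow (?V \<times> ?V)" by (auto simp: R_def equiv_def)
  then have finR: "finite R" using fin by (auto intro: finite_subset)
  let ?K = "\<lambda>q r. {f \<in> ?V \<rightarrow>\<^sub>E {..<q}. {(x, y) \<in> ?V \<times> ?V. f x = f y} = r}"
  have "card (proper_colourings G q) = (\<Sum>r\<in>R. \<Prod>i<card (?V // r). q - i)" for q
  proof -
    have "proper_colourings G q = (\<Union>r\<in>R. ?K q r)"
    proof (intro subset_antisym subsetI)
      fix f assume f: "f \<in> proper_colourings G q"
      let ?r = "{(x, y) \<in> ?V \<times> ?V. f x = f y}"
      have "equiv ?V ?r"
        by (rule equivI) (auto simp: refl_on_def sym_def trans_def)
      then have "?r \<in> R" using f by (auto simp: R_def proper_colourings_def)
      then show "f \<in> (\<Union>r\<in>R. ?K q r)" using f by (auto simp: proper_colourings_def)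
    next
      fix f assume "f \<in> (\<Union>r\<in>R. ?K q r)"
      then show "f \<in> proper_colourings G q"
        using wf by (fastforce simp: R_def proper_colourings_def)
    qed
    moreover have "finite (?K q r)" for r
      using fin by (intro finite_subset[OF _ finite_PiE[of ?V "\<lambda>_. {..<q}"]]) auto
    ultimately have "card (proper_colourings G q) = (\<Sum>r\<in>R. card (?K q r))"
      using finR by (simp only:) (subst card_UN_disjoint; auto)
    also have "\<dots> = (\<Sum>r\<in>R. \<Prod>i<card (?V // r). q - i)"
    proof (rule sum.cong)
      fix r assume "r \<in> R"
      then show "card (?K q r) = (\<Prod>i<card (?V // r). q - i)"
        using card_maps_with_kernel[of ?V r "{..<q}"] fin unfolding R_def by simp
    qed simp
    finally show ?thesis .
  qed
  then have "\<forall>q. poly (\<Sum>r\<in>R. falling_factorial [:0, 1:] (card (?V // r))) (int q) =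
               int (card (proper_colourings G q))"
    by (simp add: poly_sum poly_falling_factorial)
  then show "\<exists>p::int poly. \<forall>q::nat. poly p (of_nat q) = of_nat (card (proper_colourings G q))"
    by blast
next
  fix p p' :: "int poly"
  assume "\<forall>q::nat. poly p (of_nat q) = of_nat (card (proper_colourings G q))"
    and "\<forall>q::nat. poly p' (of_nat q) = of_nat (card (proper_colourings G q))"
  then have "range int \<subseteq> {x. poly (p - p') x = 0}" by auto
  moreover have "infinite (range int)" by (simp add: finite_image_iff)
  ultimately have "infinite {x. poly (p - p') x = 0}" using finite_subset by blast
  then show "p = p'" using poly_roots_finite[of "p - p'"] by auto
qed

lemma poly_chromatic_poly:
  assumes "graph G"
  shows "poly (chromatic_poly G) (of_nat q) = of_nat (card (proper_colourings G q))"
proof -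
  interpret graph G by fact
  have "arcs_ends G \<subseteq> verts G \<times> verts G" by (auto simp: arcs_ends_conv)
  from theI'[OF chromatic_poly_unique_existence[OF finite_verts this]]
  show ?thesis unfolding chromatic_poly_def by blast
qed

lemma complete_bipartite_digraph_exists:
  "\<exists>G :: (nat + nat, (nat + nat) \<times> (nat + nat)) pre_digraph. complete_bipartite_digraph n k G"
proof -
  let ?U = "Inl ` {..<n} :: (nat + nat) set" and ?W = "Inr ` {..<k} :: (nat + nat) set"
  let ?G = "\<lparr>pverts = ?U \<union> ?W, parcs = ?U \<times> ?W \<union> ?W \<times> ?U\<rparr>"
  have "complete_bipartite_digraph n k (with_proj ?G)"
    unfolding complete_bipartite_digraph_pair_def
    by (intro conjI exI[of _ ?U] exI[of _ ?W]) (auto simp: card_image)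
  then show ?thesis by blast
qed

text \<open>
  Since \<open>int poly\<close> is not a field, division of power series over it is not available.  The inverse
  of a series with constant coefficient 1 is \<open>fps_right_inverse f 1\<close>.  Infinite sums of power
  series refer to the topology given by the \<open>fps\<close> metric of the library (coefficientwise eventual
  equality).
\<close>

lemma prod_one_minus_inverse:
  "(\<Prod>i\<in>I. 1 - of_nat i * fps_X) * fps_right_inverse (\<Prod>i\<in>I. 1 - of_nat i * fps_X) 1 =
     (1 :: int poly fps)"
proof -
  have "fps_nth (\<Prod>i\<in>I. 1 - of_nat i * fps_X :: int poly fps) 0 = 1"
    by (induction I rule: infinite_finite_induct) (auto simp: fps_mult_nth_0)
  then show ?thesis by (intro fps_right_inverse) simp
qed

end

theory Submission
  imports Defs "HOL-Combinatorics.Stirling"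
begin

text \<open>
  Write \<open>S(n, m)\<close> for the Stirling numbers of the second kind and
  \<open>P\<^sub>m = (1 - u) (1 - 2u) \<dots> (1 - mu)\<close>.  To colour \<open>K\<^sub>n\<^sub>,\<^sub>k\<close> properly, first colour the part of size
  \<open>n\<close>; if this uses exactly \<open>m\<close> colours, every vertex of the other part may take any of the remaining
  \<open>t - m\<close> colours.  There are \<open>S(n, m) (t)\<^sub>m\<close> ways to use exactly \<open>m\<close> colours, so the chromatic
  polynomial is \<open>\<Sum>m. S(n, m) (t)\<^sub>m (t - m)\<^sup>k\<close> (\<open>chromatic_poly_complete_bipartite\<close>).

  Since \<open>\<Sum>n. S(n, m) u\<^sup>n = u\<^sup>m / P\<^sub>m\<close> (\<open>Stirling_column_gf\<close>), the left-hand side of the identity is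
  \<open>\<Sum>m. (t)\<^sub>m (t - m)\<^sup>k u\<^sup>m / P\<^sub>m\<close>.  The right-hand side has \<open>P\<^sub>m\<^sub>-\<^sub>1\<close> where this has \<open>P\<^sub>m\<close>, and
  \<open>u\<^sup>m / P\<^sub>m = u\<^sup>m / P\<^sub>m\<^sub>-\<^sub>1 + e\<^sub>m\<close> with \<open>e\<^sub>m = m u\<^sup>m\<^sup>+\<^sup>1 / P\<^sub>m\<close>.  Carrying the excess
  \<open>(t)\<^sub>m (t - m)\<^sup>k e\<^sub>m\<close> over to the next index yields the second summand in the bracket, because
  \<open>(t)\<^sub>m (t - m) = (t)\<^sub>m\<^sub>+\<^sub>1\<close>; this uses one of the \<open>k \<ge> 1\<close> factors \<open>t - m\<close>.  Hence the partial sums up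
  to \<open>M\<close> differ by a multiple of \<open>u\<^sup>M\<^sup>+\<^sup>1\<close> only (\<open>sum_Stirling_series_telescope\<close>), and so the two series
  have equal coefficients.
\<close>

section \<open>The chromatic polynomial of a complete bipartite graph\<close>

lemma falling_factorial_Suc:
  "falling_factorial x (Suc n) = falling_factorial x n * (x - of_nat n)"
  by (simp add: falling_factorial_def)

text \<open>
  This says that \<open>S(n, m) (q)\<^sub>m\<close> maps from an \<open>n\<close>-set to a \<open>q\<close>-set have an image of size \<open>m\<close>.  The
  arbitrary weight \<open>F\<close> makes a short induction possible: extending a map with image size \<open>m\<close> to one
  more point keeps the image in \<open>m\<close> ways and enlarges it in \<open>q - m\<close> ways, which amounts to applying
  the induction hypothesis to the weight \<open>m F(m) + (q - m) F(m + 1)\<close>.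
\<close>

lemma sum_maps_by_image_card:
  fixes F :: "nat \<Rightarrow> 'c :: comm_ring_1" and A :: "'a set" and Q :: "'b set"
  assumes "finite A" "finite Q"
  shows "(\<Sum>f\<in>A \<rightarrow>\<^sub>E Q. F (card (f ` A))) =
    (\<Sum>m\<le>card A. of_nat (Stirling (card A) m) * falling_factorial (of_nat (card Q)) m * F m)"
  using assms(1)
proof (induction A arbitrary: F rule: finite_induct)
  case empty
  then show ?case by (simp add: falling_factorial_def)
next
  case (insert x A)
  let ?q = "of_nat (card Q) :: 'c" and ?n = "card A"
  let ?S = "\<lambda>n m. of_nat (Stirling n m) :: 'c"
  let ?G = "\<lambda>m. of_nat m * F m + (?q - of_nat m) * F (Suc m)"
  have extend: "(\<Sum>y\<in>Q. F (card (insert y (g ` A)))) = ?G (card (g ` A))" if "g \<in> A \<rightarrow>\<^sub>E Q" for g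
  proof -
    let ?B = "g ` A"
    have B: "?B \<subseteq> Q" "finite ?B" using that insert.hyps by auto
    have "(\<Sum>y\<in>Q. F (card (insert y ?B))) =
        (\<Sum>y\<in>?B. F (card (insert y ?B))) + (\<Sum>y\<in>Q - ?B. F (card (insert y ?B)))"
      using B assms(2) by (metis add.commute sum.subset_diff)
    also have "(\<Sum>y\<in>?B. F (card (insert y ?B))) = (\<Sum>y\<in>?B. F (card ?B))"
      by (intro sum.cong) (auto simp: insert_absorb)
    also have "(\<Sum>y\<in>Q - ?B. F (card (insert y ?B))) = (\<Sum>y\<in>Q - ?B. F (Suc (card ?B)))"
      using B by (intro sum.cong) auto
    also have "of_nat (card (Q - ?B)) = ?q - of_nat (card ?B)"
      using B assms(2) by (simp add: card_Diff_subset card_mono of_nat_diff)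
    ultimately show ?thesis by (simp add: card_Diff_subset)
  qed
  have "(\<Sum>f\<in>insert x A \<rightarrow>\<^sub>E Q. F (card (f ` insert x A))) =
      (\<Sum>(y, g)\<in>Q \<times> (A \<rightarrow>\<^sub>E Q). F (card ((g(x := y)) ` insert x A)))"
    unfolding PiE_insert_eq
    by (subst sum.reindex[OF inj_combinator]) (use insert.hyps in \<open>auto simp: case_prod_unfold\<close>)
  also have "\<dots> = (\<Sum>(y, g)\<in>Q \<times> (A \<rightarrow>\<^sub>E Q). F (card (insert y (g ` A))))"
  proof -
    have "(g(x := y)) ` insert x A = insert y (g ` A)" for g :: "'a \<Rightarrow> 'b" and y
      using insert.hyps by (auto simp: image_iff)
    then show ?thesis by simp
  qed
  also have "\<dots> = (\<Sum>g\<in>A \<rightarrow>\<^sub>E Q. \<Sum>y\<in>Q. F (card (insert y (g ` A))))"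
    by (subst sum.swap) (simp add: sum.cartesian_product)
  also have "\<dots> = (\<Sum>g\<in>A \<rightarrow>\<^sub>E Q. ?G (card (g ` A)))"
    by (intro sum.cong refl extend)
  also have "\<dots> = (\<Sum>m\<le>?n. ?S ?n m * falling_factorial ?q m * ?G m)"
    by (rule insert.IH)
  \<comment> \<open>The factor \<open>q - m\<close> turns \<open>(q)\<^sub>m\<close> into \<open>(q)\<^sub>m\<^sub>+\<^sub>1\<close>; shifting the index then exhibits the recurrence
    of the Stirling numbers.\<close>
  also have "\<dots> = (\<Sum>m\<le>?n. of_nat m * ?S ?n m * falling_factorial ?q m * F m) +
      (\<Sum>m\<le>?n. ?S ?n m * falling_factorial ?q (Suc m) * F (Suc m))"
    unfolding sum.distrib[symmetric]
    by (intro sum.cong refl) (simp add: falling_factorial_Suc algebra_simps)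
  also have "(\<Sum>m\<le>?n. of_nat m * ?S ?n m * falling_factorial ?q m * F m) =
      (\<Sum>m\<le>Suc ?n. of_nat m * ?S ?n m * falling_factorial ?q m * F m)"
    by simp
  also have "\<dots> = (\<Sum>m\<le>?n. of_nat (Suc m) * ?S ?n (Suc m) *
      falling_factorial ?q (Suc m) * F (Suc m))"
    by (subst sum.atMost_Suc_shift) simp
  also have "\<dots> + (\<Sum>m\<le>?n. ?S ?n m * falling_factorial ?q (Suc m) * F (Suc m)) =
      (\<Sum>m\<le>?n. ?S (Suc ?n) (Suc m) * falling_factorial ?q (Suc m) * F (Suc m))"
    unfolding sum.distrib[symmetric]
    by (intro sum.cong refl) (simp add: algebra_simps)
  also have "\<dots> = (\<Sum>m\<le>Suc ?n. ?S (Suc ?n) m * falling_factorial ?q m * F m)"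
    by (simp only: sum.atMost_Suc_shift) simp
  finally show ?case using insert.hyps by simp
qed

text \<open>
  A proper colouring is a colouring of the first part together with a colouring of the second part
  that avoids the colours used on the first.
\<close>

lemma card_proper_colourings_complete_bipartite:
  fixes G :: "('a, 'b) pre_digraph"
  assumes "complete_bipartite_digraph n k G"
  shows "int (card (proper_colourings G q)) =
    (\<Sum>m\<le>n. of_nat (Stirling n m) * falling_factorial (int q) m * (int q - int m) ^ k)"
proof -
  obtain U W where UW: "verts G = U \<union> W" "U \<inter> W = {}" "card U = n" "card W = k"
      "arcs_ends G = U \<times> W \<union> W \<times> U" and "graph G"
    using assms unfolding complete_bipartite_digraph_def by blast
  interpret graph G by fact
  have fin: "finite U" "finite W" using UW(1) finite_verts by simp_all
  have W_notin_U: "w \<notin> U" if "w \<in> W" for w using UW(2) that by blast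
  let ?Q = "{..<q}"
  let ?P = "SIGMA f:U \<rightarrow>\<^sub>E ?Q. W \<rightarrow>\<^sub>E (?Q - f ` U)"
  have proper: "f w \<noteq> f v" if "f \<in> proper_colourings G q" "v \<in> U" "w \<in> W" for f v w
    using that by (force simp: proper_colourings_def UW)
  have "bij_betw (\<lambda>f. (restrict f U, restrict f W)) (proper_colourings G q) ?P"
  proof (rule bij_betw_byWitness[where f' = "\<lambda>(f, g) x. if x \<in> U then f x else g x"])
    show "\<forall>f\<in>proper_colourings G q.
        (case (restrict f U, restrict f W) of (f, g) \<Rightarrow> \<lambda>x. if x \<in> U then f x else g x) = f"
      by (auto simp: proper_colourings_def UW PiE_def extensional_def fun_eq_iff)
    show "\<forall>p\<in>?P. (\<lambda>f. (restrict f U, restrict f W))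
        (case p of (f, g) \<Rightarrow> \<lambda>x. if x \<in> U then f x else g x) = p"
      using UW(2) by (auto simp: PiE_def extensional_def fun_eq_iff restrict_def)
    show "(\<lambda>f. (restrict f U, restrict f W)) ` proper_colourings G q \<subseteq> ?P"
      using proper by (auto simp: proper_colourings_def UW(1))
    show "(\<lambda>(f, g) x. if x \<in> U then f x else g x) ` ?P \<subseteq> proper_colourings G q"
      by (fastforce simp: proper_colourings_def UW(1,5) PiE_def Pi_def extensional_def image_iff W_notin_U)
  qed
  then have "card (proper_colourings G q) = card ?P"
    by (rule bij_betw_same_card)
  also have "\<dots> = (\<Sum>f\<in>U \<rightarrow>\<^sub>E ?Q. card (W \<rightarrow>\<^sub>E (?Q - f ` U)))"
    using fin by (intro card_SigmaI) (auto intro!: finite_PiE)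
  also have "int \<dots> = (\<Sum>f\<in>U \<rightarrow>\<^sub>E ?Q. (int q - int (card (f ` U))) ^ k)"
    unfolding of_nat_sum
  proof (intro sum.cong refl)
    fix f assume "f \<in> U \<rightarrow>\<^sub>E ?Q"
    then have f: "f ` U \<subseteq> ?Q" by auto
    then have "card (f ` U) \<le> q" by (metis card_lessThan card_mono finite_lessThan)
    then show "int (card (W \<rightarrow>\<^sub>E (?Q - f ` U))) = (int q - int (card (f ` U))) ^ k"
      using f fin UW by (simp add: card_funcsetE card_Diff_subset of_nat_diff)
  qed
  also have "\<dots> = (\<Sum>m\<le>n. of_nat (Stirling n m) * falling_factorial (int q) m * (int q - int m) ^ k)"
    using sum_maps_by_image_card[of U ?Q "\<lambda>m. (int q - int m) ^ k"] fin UW(3) by simp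
  finally show ?thesis .
qed

lemma chromatic_poly_complete_bipartite:
  fixes G :: "('a, 'b) pre_digraph"
  assumes "complete_bipartite_digraph n k G"
  shows "chromatic_poly G =
    (\<Sum>m\<le>n. of_nat (Stirling n m) * falling_factorial [:0, 1:] m * ([:0, 1:] - of_nat m) ^ k)"
    (is "_ = ?p")
proof -
  interpret graph G using assms unfolding complete_bipartite_digraph_def by blast
  have "poly ?p (int q) = int (card (proper_colourings G q))" for q
    unfolding card_proper_colourings_complete_bipartite[OF assms] poly_sum
    by (simp add: falling_factorial_def poly_prod)
  moreover have "\<exists>!p. \<forall>q. poly p (int q) = int (card (proper_colourings G q))"
    by (rule chromatic_poly_unique_existence) (auto simp: arcs_ends_conv)
  ultimately show ?thesis
    unfolding chromatic_poly_def by (intro the1_equality) auto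
qed

section \<open>Generating functions of Stirling numbers\<close>

definition stirling_denom :: "nat \<Rightarrow> int poly fps" where
  "stirling_denom m = (\<Prod>i = 0..m. 1 - of_nat i * fps_X)"

abbreviation recip_denom :: "nat \<Rightarrow> int poly fps" where
  "recip_denom m \<equiv> fps_right_inverse (stirling_denom m) 1"

lemma denom_mult_recip: "stirling_denom m * recip_denom m = 1"
  unfolding stirling_denom_def by (rule prod_one_minus_inverse)

lemma recip_denom_Suc: "recip_denom m = (1 - of_nat (Suc m) * fps_X) * recip_denom (Suc m)"
proof -
  have "recip_denom m = recip_denom m * (stirling_denom (Suc m) * recip_denom (Suc m))"
    by (simp only: denom_mult_recip mult_1_right)
  also have "\<dots> = (stirling_denom m * recip_denom m) *
      ((1 - of_nat (Suc m) * fps_X) * recip_denom (Suc m))"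
    by (simp only: stirling_denom_def prod.atLeast0_atMost_Suc mult_ac)
  finally show ?thesis by (simp only: denom_mult_recip mult_1_left)
qed

text \<open>
  The recurrence of the Stirling numbers says that the series \<open>Q\<^sub>m\<close> of column \<open>m\<close> satisfies
  \<open>(1 - (m + 1) u) Q\<^sub>m\<^sub>+\<^sub>1 = u Q\<^sub>m\<close>.
\<close>

lemma Stirling_column_gf:
  "Abs_fps (\<lambda>n. of_nat (Stirling n m)) = fps_X ^ m * recip_denom m"
proof (induction m)
  case 0
  have "Abs_fps (\<lambda>n. of_nat (Stirling n 0)) = (1 :: int poly fps)"
    by (rule fps_ext) (case_tac n; simp)
  moreover have "stirling_denom 0 = 1" by (simp add: stirling_denom_def)
  ultimately show ?case using denom_mult_recip[of 0] by simp
next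
  case (Suc m)
  let ?Q = "\<lambda>m. Abs_fps (\<lambda>n. of_nat (Stirling n m)) :: int poly fps"
  have rec: "(1 - of_nat (Suc m) * fps_X) * ?Q (Suc m) = fps_X * ?Q m"
  proof (rule fps_ext)
    fix n
    show "((1 - of_nat (Suc m) * fps_X) * ?Q (Suc m)) $ n = (fps_X * ?Q m) $ n"
      by (cases n) (simp_all add: left_diff_distrib mult.assoc fps_of_nat[symmetric] algebra_simps del: fps_of_nat)
  qed
  have "?Q (Suc m) = (stirling_denom (Suc m) * recip_denom (Suc m)) * ?Q (Suc m)"
    by (simp only: denom_mult_recip mult_1_left)
  also have "\<dots> = stirling_denom m * recip_denom (Suc m) *
      ((1 - of_nat (Suc m) * fps_X) * ?Q (Suc m))"
    by (simp only: stirling_denom_def prod.atLeast0_atMost_Suc mult_ac)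
  also have "\<dots> = (stirling_denom m * recip_denom m) * (fps_X ^ Suc m * recip_denom (Suc m))"
    unfolding rec Suc.IH by (simp only: power_Suc mult_ac)
  finally show ?case by (simp only: denom_mult_recip mult_1_left)
qed

text \<open>
  The excess of the left-hand summand \<open>m\<close> over the first half of the right-hand summand \<open>m\<close> is
  \<open>m c\<^sub>m u\<^sup>m\<^sup>+\<^sup>1 / P\<^sub>m\<close>, which is the second half of the right-hand summand \<open>m + 1\<close>.  Only the last
  excess remains.
\<close>

lemma sum_Stirling_series_telescope:
  fixes k M :: nat and t :: "int poly"
  assumes "k \<ge> 1"
  defines "c \<equiv> \<lambda>m. falling_factorial t m * (t - of_nat m) ^ k"
  shows "(\<Sum>m=1..M. fps_const (c m) * (fps_X ^ m * recip_denom m)) =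
    (\<Sum>m=1..M. fps_const (falling_factorial t m *
        ((t - of_nat m) ^ k + (of_nat m - 1) * (t - (of_nat m - 1)) ^ (k - 1))) *
      fps_X ^ m * recip_denom (m - 1)) +
    fps_const (of_nat M * c M) * fps_X ^ Suc M * recip_denom M"
proof (induction M)
  case 0
  then show ?case by simp
next
  case (Suc M)
  obtain l where k: "k = Suc l" using assms(1) by (cases k) auto
  let ?N = "Suc M" and ?u = "fps_X :: int poly fps"
  \<comment> \<open>This absorption needs one factor \<open>t - M\<close> of \<open>c M\<close>, hence \<open>k \<ge> 1\<close>.\<close>
  have c: "falling_factorial t ?N * (of_nat ?N - 1) * (t - (of_nat ?N - 1)) ^ (k - 1) =
      of_nat M * c M"
    by (simp add: c_def k falling_factorial_Suc)
  have "fps_const (falling_factorial t ?N *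
        ((t - of_nat ?N) ^ k + (of_nat ?N - 1) * (t - (of_nat ?N - 1)) ^ (k - 1))) *
      ?u ^ ?N * recip_denom M =
      fps_const (c ?N + of_nat M * c M) * ?u ^ ?N * recip_denom M"
    unfolding c[symmetric] by (simp only: c_def distrib_left mult.assoc)
  also have "\<dots> = fps_const (c ?N) * ?u ^ ?N * recip_denom M +
      fps_const (of_nat M * c M) * ?u ^ ?N * recip_denom M"
    by (simp only: fps_const_add[symmetric] distrib_right)
  also have "fps_const (c ?N) * ?u ^ ?N * recip_denom M =
      fps_const (c ?N) * (?u ^ ?N * recip_denom ?N) -
      fps_const (of_nat ?N * c ?N) * ?u ^ Suc ?N * recip_denom ?N"
    unfolding recip_denom_Suc[of M] fps_const_mult[symmetric] fps_of_nat power_Suc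
    by (simp only: algebra_simps mult_1_left)
  finally show ?case
    unfolding sum.atLeast_Suc_atMost_Suc_shift using Suc.IH
    by (simp add: algebra_simps)
qed

section \<open>Infinite sums of formal power series\<close>

text \<open>
  Convergence of power series is coefficientwise eventual equality, so a family in which each
  coefficient is nonzero for only finitely many members can be summed coefficient by coefficient.
\<close>

lemma has_sum_fps_locally_finite:
  fixes f :: "'i \<Rightarrow> 'a :: ab_group_add fps"
  assumes "\<And>j. finite (B j)" "\<And>j. B j \<subseteq> A" "\<And>i j. i \<in> A - B j \<Longrightarrow> f i $ j = 0"
  shows "(f has_sum Abs_fps (\<lambda>j. \<Sum>i\<in>B j. f i $ j)) A"
  unfolding has_sum_def
proof (rule tendsto_fpsI)
  fix j
  show "\<forall>\<^sub>F F in finite_subsets_at_top A. sum f F $ j = Abs_fps (\<lambda>j. \<Sum>i\<in>B j. f i $ j) $ j"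
    unfolding eventually_finite_subsets_at_top
  proof (intro exI[of _ "B j"] conjI allI impI)
    fix F assume "finite F \<and> B j \<subseteq> F \<and> F \<subseteq> A"
    then show "sum f F $ j = Abs_fps (\<lambda>j. \<Sum>i\<in>B j. f i $ j) $ j"
      using assms(3)[of _ j] by (auto simp: fps_sum_nth intro!: sum.mono_neutral_right)
  qed (use assms in auto)
qed

section \<open>The generating function identity\<close>

theorem theorem5p5:
  fixes k :: nat and K :: "nat \<Rightarrow> ('a, 'b) pre_digraph"
  assumes "k \<ge> 1"
    and "\<And>n. n \<ge> 1 \<Longrightarrow> complete_bipartite_digraph n k (K n)"
  shows "let t = [:0, 1:] :: int poly;
             u = fps_X :: int poly fps;
             a = (\<lambda>n. fps_const (chromatic_poly (K n)) * u ^ n);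
             b = (\<lambda>n. fps_const (falling_factorial t n *
                         ((t - of_nat n) ^ k + (of_nat n - 1) * (t - (of_nat n - 1)) ^ (k - 1))) *
                      u ^ n * fps_right_inverse (\<Prod>i = 0..n - 1. 1 - of_nat i * u) 1)
         in a summable_on {1..} \<and> b summable_on {1..} \<and>
            (\<Sum>\<^sub>\<infinity>n\<in>{1..}. a n) = (\<Sum>\<^sub>\<infinity>n\<in>{1..}. b n)"
proof -
  define t where "t = ([:0, 1:] :: int poly)"
  define u where "u = (fps_X :: int poly fps)"
  define a where "a = (\<lambda>n. fps_const (chromatic_poly (K n)) * u ^ n)"
  define b where "b = (\<lambda>n. fps_const (falling_factorial t n *
      ((t - of_nat n) ^ k + (of_nat n - 1) * (t - (of_nat n - 1)) ^ (k - 1))) *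
      u ^ n * recip_denom (n - 1))"
  have a_nth: "a n $ j = (if j = n then chromatic_poly (K n) else 0)" for n j
    by (simp add: a_def u_def)
  have b_nth: "b n $ j = 0" if "j < n" for n j
    using that by (simp add: b_def u_def mult.assoc fps_X_power_mult_nth)
  have coeff: "(\<Sum>n=1..j. a n $ j) = (\<Sum>n=1..j. b n $ j)" for j
  proof (cases "j = 0")
    case False
    define c where "c = (\<lambda>m. falling_factorial t m * (t - of_nat m) ^ k)"
    have "(\<Sum>n=1..j. a n $ j) = chromatic_poly (K j)"
      using False by (simp add: a_nth)
    also have "\<dots> = (\<Sum>m\<le>j. c m * of_nat (Stirling j m))"
      using chromatic_poly_complete_bipartite[of j k "K j"] assms(2)[of j] False
      by (simp add: c_def t_def mult_ac)
    also have "\<dots> = (\<Sum>m=1..j. c m * of_nat (Stirling j m))"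
      using False by (intro sum.mono_neutral_right) (auto simp: not_less_eq_eq gr0_conv_Suc)
    also have "\<dots> = (\<Sum>m=1..j. fps_const (c m) * (u ^ m * recip_denom m)) $ j"
      unfolding u_def Stirling_column_gf[symmetric] by (simp add: fps_sum_nth)
    \<comment> \<open>The remainder of the telescoping sum is divisible by \<open>u\<close> to the power \<open>j + 1\<close>.\<close>
    also have "\<dots> = (\<Sum>n=1..j. b n) $ j"
      unfolding c_def u_def sum_Stirling_series_telescope[OF assms(1)]
      by (simp add: b_def u_def mult.assoc fps_X_power_mult_nth del: power_Suc)
    finally show ?thesis by (simp add: fps_sum_nth)
  qed simp
  have "(a has_sum Abs_fps (\<lambda>j. \<Sum>n=1..j. a n $ j)) {1..}"
    by (rule has_sum_fps_locally_finite) (auto simp: a_nth)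
  moreover have "(b has_sum Abs_fps (\<lambda>j. \<Sum>n=1..j. a n $ j)) {1..}"
    unfolding coeff by (rule has_sum_fps_locally_finite) (auto simp: b_nth)
  ultimately have "a summable_on {1..} \<and> b summable_on {1..} \<and>
      (\<Sum>\<^sub>\<infinity>n\<in>{1..}. a n) = (\<Sum>\<^sub>\<infinity>n\<in>{1..}. b n)"
    by (simp add: has_sum_iff)
  then show ?thesis
    unfolding Let_def a_def b_def t_def u_def stirling_denom_def .
qed

end
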